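(* Let $s>0$ be real, let $\lambda_1,\ldots,\lambda_r$ be positive integers, $N=\lambda_1+\cdots+\lambda_r$, and $$H_s(K_{\lambda_1,\ldots,\lambda_r})=(-1)^N\chi_{K_{\lambda_1,\ldots,\lambda_r}}(-s).$$ Then $$H_s(K_{\lambda_1,\ldots,\lambda_r})=\frac1{\Gamma(s)}\int_0^\infty e^{-t}t^{s-1}\prod_{i=1}^rP_{\lambda_i}(t)\,dt.$$ If the graph $G=K_{\lambda_1,\ldots,\lambda_r}$ is connected, then $H_s(G)=s\,T_G(1+s,0)$.
   Context: $\chi_G$ is the chromatic polynomial and $T_G(x,y)$ the Tutte polynomial of $G$. $K_{\lambda_1,\ldots,\lambda_r}$ is the complete multipartite graph with parts of sizes $\lambda_1,\ldots,\lambda_r$. For $m\ge1$, $P_m(t)=\sum_{j=1}^m(-1)^{m+j}S(m,j)t^j$, where $S(m,j)$ is the Stirling number of the second kind. *)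

theory Defs
  imports "HOL-Analysis.Analysis" "HOL-Combinatorics.Stirling"
    "HOL-Computational_Algebra.Polynomial"
begin

record 'a sgraph =
  verts :: "'a set"
  edges :: "'a set set"

definition adj_rel :: "'a set set \<Rightarrow> ('a \<times> 'a) set" where
  "adj_rel A = {(u, v). {u, v} \<in> A}"

definition num_components :: "'a sgraph \<Rightarrow> 'a set set \<Rightarrow> nat" where
  "num_components G A = card (verts G // ((adj_rel A)\<^sup>* \<inter> verts G \<times> verts G))"

(* The graph without vertices counts as disconnected. *)
definition connected_graph :: "'a sgraph \<Rightarrow> bool" where
  "connected_graph G \<longleftrightarrow>
    verts G \<noteq> {} \<and> (\<forall>u\<in>verts G. \<forall>v\<in>verts G. (u, v) \<in> (adj_rel (edges G))\<^sup>*)"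

definition proper_colourings :: "'a sgraph \<Rightarrow> nat \<Rightarrow> ('a \<Rightarrow> nat) set" where
  "proper_colourings G q =
    {c \<in> verts G \<rightarrow>\<^sub>E {..<q}. \<forall>u\<in>verts G. \<forall>v\<in>verts G. {u, v} \<in> edges G \<longrightarrow> c u \<noteq> c v}"

(* For a finite graph exactly one such polynomial exists. *)
definition chromatic_poly :: "'a sgraph \<Rightarrow> real poly" where
  "chromatic_poly G =
    (THE p. \<forall>q::nat. poly p (of_nat q) = of_nat (card (proper_colourings G q)))"

definition graph_rank :: "'a sgraph \<Rightarrow> 'a set set \<Rightarrow> nat" where
  "graph_rank G A = card (verts G) - num_components G A"

(* Rank generating expansion over spanning subgraphs, evaluated at (x, y). For a finite
   simple graph none of the subtractions on nat truncates. *)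
definition tutte :: "'a sgraph \<Rightarrow> real \<Rightarrow> real \<Rightarrow> real" where
  "tutte G x y =
    (\<Sum>A\<in>Pow (edges G).
      (x - 1) ^ (graph_rank G (edges G) - graph_rank G A) *
      (y - 1) ^ (card A - graph_rank G A))"

(* The vertex (i, j) is the j-th vertex of the i-th part. *)
definition complete_multipartite :: "nat \<Rightarrow> (nat \<Rightarrow> nat) \<Rightarrow> (nat \<times> nat) sgraph" where
  "complete_multipartite r lam =
    (let V = (SIGMA i:{1..r}. {1..lam i})
     in \<lparr>verts = V, edges = {{u, v} | u v. u \<in> V \<and> v \<in> V \<and> fst u \<noteq> fst v}\<rparr>)"

definition P :: "nat \<Rightarrow> real \<Rightarrow> real" where
  "P m t = (\<Sum>j=1..m. (-1) ^ (m + j) * real (Stirling m j) * t ^ j)"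

end

theory Submission
  imports Defs
begin

text \<open>
  Colouring the parts one after the other shows that the chromatic polynomial of the complete
  multipartite graph arises from $\prod_i \sum_j S(\lambda_i, j)\, t^j$ by replacing each power
  $t^n$ with the falling factorial $x(x-1)\cdots(x-n+1)$. At $x = -s$ that factorial is
  $(-1)^n \Gamma(s+n) / \Gamma(s)$, which up to the sign is the integral of $t^n$ against the
  Gamma density; this gives the integral formula.
  The Tutte evaluation follows by comparing the subgraph expansion of $T_G$ with Whitney's
  expansion $\chi_G(q) = \sum_A (-1)^{|A|} q^{k(A)}$ term by term.
\<close>

section \<open>Falling factorials and the umbral substitution\<close>

definition falling_poly :: "nat \<Rightarrow> real poly" where
  "falling_poly n = (\<Prod>i<n. [:- real i, 1:])"

lemma falling_poly_0 [simp]: "falling_poly 0 = 1"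
  by (simp add: falling_poly_def)

lemma poly_falling_poly_Suc: "poly (falling_poly (Suc n)) x = poly (falling_poly n) x * (x - real n)"
  by (simp add: falling_poly_def algebra_simps)

text \<open>Splits off the first factor of the product instead of the last; the remaining factors
  form a falling factorial at \<open>x - 1\<close>.\<close>

lemma poly_falling_poly_Suc_shift:
  "poly (falling_poly (Suc n)) x = x * poly (falling_poly n) (x - 1)"
  by (simp add: falling_poly_def poly_prod prod.lessThan_Suc_shift algebra_simps del: prod.lessThan_Suc)

text \<open>At a negative argument falling factorials become rising ones, which are the moments of
  the Gamma density.\<close>

lemma poly_falling_poly_minus: "poly (falling_poly n) (- x) = (-1) ^ n * pochhammer x n"
  by (induction n) (simp_all add: poly_falling_poly_Suc pochhammer_Suc algebra_simps)

text \<open>The umbral substitution $t^n \mapsto x(x-1)\cdots(x-n+1)$.\<close>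

definition umbral_falling :: "real poly \<Rightarrow> real poly" where
  "umbral_falling p = (\<Sum>n\<le>degree p. smult (coeff p n) (falling_poly n))"

text \<open>Padding with zero coefficients gives polynomials of different degrees a common summation
  range, which makes linearity a termwise matter.\<close>

lemma umbral_falling_bound:
  assumes "degree p \<le> d"
  shows "umbral_falling p = (\<Sum>n\<le>d. smult (coeff p n) (falling_poly n))"
  unfolding umbral_falling_def
  by (rule sum.mono_neutral_left) (use assms in \<open>auto simp: coeff_eq_0\<close>)

lemma umbral_falling_add: "umbral_falling (p + q) = umbral_falling p + umbral_falling q"
proof -
  define d where "d = max (degree p) (degree q)"
  have "degree p \<le> d" "degree q \<le> d" "degree (p + q) \<le> d"
    by (auto simp: d_def degree_add_le_max)
  then show ?thesis
    by (simp add: umbral_falling_bound[of _ d] smult_add_left sum.distrib)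
qed

lemma smult_sum_right: "smult c (\<Sum>x\<in>A. f x) = (\<Sum>x\<in>A. smult c (f x))"
  by (induction A rule: infinite_finite_induct) (simp_all add: smult_add_right)

lemma umbral_falling_smult: "umbral_falling (smult c p) = smult c (umbral_falling p)"
  by (simp add: umbral_falling_bound[of "smult c p" "degree p"] umbral_falling_bound[of p "degree p"]
      degree_smult_le smult_sum_right)

lemma umbral_falling_1 [simp]: "umbral_falling 1 = 1"
  by (simp add: umbral_falling_def)

lemma umbral_falling_0 [simp]: "umbral_falling 0 = 0"
  by (simp add: umbral_falling_def)

lemma umbral_falling_sum: "umbral_falling (sum f A) = (\<Sum>x\<in>A. umbral_falling (f x))"
  by (induction A rule: infinite_finite_induct) (simp_all add: umbral_falling_add)

text \<open>Multiplication by \<open>t\<close> raises the index of every falling factorial by one;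
  splitting off the first factor \<open>x\<close> from each leaves the old ones at
  \<open>x - 1\<close>.\<close>

lemma poly_umbral_falling_pCons_0:
  "poly (umbral_falling (pCons 0 p)) x = x * poly (umbral_falling p) (x - 1)"
proof -
  have "poly (umbral_falling (pCons 0 p)) x =
      (\<Sum>n\<le>Suc (degree p). coeff (pCons 0 p) n * poly (falling_poly n) x)"
    by (subst umbral_falling_bound[OF degree_pCons_le]) (simp add: poly_sum)
  also have "\<dots> = (\<Sum>n\<le>degree p. coeff p n * (x * poly (falling_poly n) (x - 1)))"
    by (simp add: sum.atMost_Suc_shift poly_falling_poly_Suc_shift del: sum.atMost_Suc)
  finally show ?thesis
    by (simp add: umbral_falling_def poly_sum sum_distrib_left mult_ac)
qed

text \<open>Algebraic counterpart of colouring one part with exactly \<open>j\<close> colours: they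
  are chosen in order from \<open>x\<close>, and the other parts are left with
  \<open>x - j\<close>.\<close>

lemma poly_umbral_falling_monom_mult:
  "poly (umbral_falling (monom 1 j * p)) x =
    poly (falling_poly j) x * poly (umbral_falling p) (x - real j)"
proof (induction j arbitrary: x)
  case 0
  show ?case by (simp add: monom_0 flip: one_pCons)
next
  case (Suc j)
  have "monom 1 (Suc j) * p = pCons 0 (monom 1 j * p)"
    by (simp add: monom_Suc)
  then show ?case
    by (simp add: poly_umbral_falling_pCons_0 Suc.IH poly_falling_poly_Suc_shift mult.assoc diff_diff_eq)
qed

section \<open>Stirling numbers and functions counted by image size\<close>

text \<open>This is the recurrence S(m+1, j+1) = (j+1) S(m, j+1) + S(m, j), summed against a weight:
  a new element takes one of \<open>j\<close> old values or one of \<open>x - j\<close> fresh ones.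
  \<open>F\<close> stands for the falling factorials at \<open>x\<close>.\<close>

lemma sum_Stirling_Suc:
  fixes F h :: "nat \<Rightarrow> real"
  assumes "\<And>j. F (Suc j) = F j * (x - real j)"
  shows "(\<Sum>j\<le>m. real (Stirling m j) * F j * (real j * h j + (x - real j) * h (Suc j))) =
         (\<Sum>j\<le>Suc m. real (Stirling (Suc m) j) * F j * h j)"
proof -
  \<comment> \<open>The index shift is exact: the added term at 0 carries the factor
    \<open>real 0\<close>, and the one at \<open>Suc m\<close> vanishes because S(m, m+1) =
    0.\<close>
  have "(\<Sum>j\<le>m. real (Stirling m (Suc j)) * F (Suc j) * (real (Suc j) * h (Suc j)))
      = (\<Sum>j\<le>Suc m. real (Stirling m j) * F j * (real j * h j))"
    by (simp only: sum.atMost_Suc_shift)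
  also have "\<dots> = (\<Sum>j\<le>m. real (Stirling m j) * F j * (real j * h j))"
    by simp
  finally have *: "(\<Sum>j\<le>m. real (Stirling m (Suc j)) * F (Suc j) * (real (Suc j) * h (Suc j))) = \<dots>" .
  have "(\<Sum>j\<le>Suc m. real (Stirling (Suc m) j) * F j * h j)
      = (\<Sum>j\<le>m. real (Stirling m (Suc j)) * F (Suc j) * (real (Suc j) * h (Suc j))
          + real (Stirling m j) * F (Suc j) * h (Suc j))"
    by (simp only: sum.atMost_Suc_shift) (simp add: algebra_simps)
  also have "\<dots> = (\<Sum>j\<le>m. real (Stirling m j) * F j * (real j * h j) +
      real (Stirling m j) * F (Suc j) * h (Suc j))"
    by (simp only: sum.distrib *)
  also have "\<dots> = (\<Sum>j\<le>m. real (Stirling m j) * F j * (real j * h j + (x - real j) * h (Suc j)))"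
    by (intro sum.cong) (simp_all add: assms algebra_simps)
  finally show ?thesis ..
qed

text \<open>A function with \<open>j\<close> values is a partition of \<open>A\<close> into
  \<open>j\<close> blocks together with an injective choice of values. The weight \<open>h\<close>
  is arbitrary because the induction changes it.\<close>

lemma sum_functions_card_image:
  fixes h :: "nat \<Rightarrow> real"
  assumes "finite A" "finite C"
  shows "(\<Sum>f\<in>A \<rightarrow>\<^sub>E C. h (card (f ` A))) =
    (\<Sum>j\<le>card A. real (Stirling (card A) j) * poly (falling_poly j) (card C) * h j)"
  using assms(1)
proof (induction A arbitrary: h rule: finite_induct)
  case empty
  show ?case by simp
next
  case (insert a A)
  let ?k = "\<lambda>f. card (f ` A)"
  have "(\<Sum>f\<in>insert a A \<rightarrow>\<^sub>E C. h (card (f ` insert a A))) =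
    (\<Sum>(y, f)\<in>C \<times> (A \<rightarrow>\<^sub>E C). h (card ((f(a := y)) ` insert a A)))"
    by (subst PiE_insert_eq, subst sum.reindex[OF inj_combinator[OF insert.hyps(2)]])
      (simp only: o_def case_prod_unfold)
  also have "\<dots> = (\<Sum>f\<in>A \<rightarrow>\<^sub>E C. \<Sum>y\<in>C. h (card ((f(a := y)) ` insert a A)))"
    by (subst sum.cartesian_product[symmetric]) (rule sum.swap)
  \<comment> \<open>The value \<open>y\<close> of the new element lies in the old image, whose size
    then stays the same, or outside it, and then the size grows by one.\<close>
  also have "\<dots> = (\<Sum>f\<in>A \<rightarrow>\<^sub>E C. real (?k f) * h (?k f) + (real (card C) - real (?k f)) * h (Suc (?k f)))"
  proof (rule sum.cong [OF refl])
    fix f assume f: "f \<in> A \<rightarrow>\<^sub>E C"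
    have fin: "finite (f ` A)" and sub: "f ` A \<subseteq> C"
      using f insert.hyps(1) by auto
    have "(\<Sum>y\<in>C. h (card ((f(a := y)) ` insert a A))) = (\<Sum>y\<in>C. h (card (insert y (f ` A))))"
      using insert.hyps(2) by (intro sum.cong refl arg_cong[where f = h] arg_cong[where f = card]) auto
    also have "\<dots> = (\<Sum>y\<in>C - f ` A. h (Suc (?k f))) + (\<Sum>y\<in>f ` A. h (?k f))"
      unfolding sum.subset_diff[OF sub assms(2)]
      by (intro arg_cong2[where f = "(+)"] sum.cong refl) (use fin in \<open>auto simp: insert_absorb\<close>)
    also have "\<dots> = real (?k f) * h (?k f) + (real (card C) - real (?k f)) * h (Suc (?k f))"
      using card_mono[OF assms(2) sub] by (simp add: card_Diff_subset[OF fin sub] of_nat_diff)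
    finally show "(\<Sum>y\<in>C. h (card ((f(a := y)) ` insert a A))) = \<dots>" .
  qed
  \<comment> \<open>The induction hypothesis is applied to the new weight
    \<open>j * h j + (card C - j) * h (Suc j)\<close>.\<close>
  also have "\<dots> = (\<Sum>j\<le>card A. real (Stirling (card A) j) * poly (falling_poly j) (card C) *
      (real j * h j + (real (card C) - real j) * h (Suc j)))"
    by (rule insert.IH)
  also have "\<dots> = (\<Sum>j\<le>Suc (card A). real (Stirling (Suc (card A)) j) * poly (falling_poly j) (card C) * h j)"
    by (rule sum_Stirling_Suc) (simp add: poly_falling_poly_Suc)
  finally show ?case
    using insert.hyps by simp
qed

section \<open>Chromatic polynomial of the complete multipartite graph\<close>

text \<open>The Touchard polynomial, an unsigned form of \<open>P\<close>.\<close>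

definition stirling_poly :: "nat \<Rightarrow> real poly" where
  "stirling_poly m = (\<Sum>j\<le>m. smult (real (Stirling m j)) (monom 1 j))"

lemma P_eq_stirling_poly:
  assumes "m > 0"
  shows "P m t = (-1) ^ m * poly (stirling_poly m) (- t)"
proof -
  \<comment> \<open>The sum in \<open>P\<close> starts at 1, so the term at 0 has to vanish; this is
    where positivity of \<open>m\<close> enters, since S(0, 0) = 1.\<close>
  have S0: "Stirling m 0 = 0"
    using assms by (cases m) auto
  have "(-1) ^ m * poly (stirling_poly m) (- t) =
      (\<Sum>j\<le>m. (-1) ^ (m + j) * real (Stirling m j) * t ^ j)"
    by (simp add: stirling_poly_def poly_sum poly_monom sum_distrib_left power_add
        power_minus[of t] mult_ac)
  also have "\<dots> = P m t"
    unfolding P_def by (rule sum.mono_neutral_right) (auto simp: S0 not_le)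
  finally show ?thesis ..
qed

text \<open>Arbitrary index and colour sets let the induction remove one part together with the
  colours used on it.\<close>

definition part_colourings :: "'i set \<Rightarrow> ('i \<Rightarrow> 'b set) \<Rightarrow> 'c set \<Rightarrow> ('i \<times> 'b \<Rightarrow> 'c) set" where
  "part_colourings I B C =
    {c \<in> Sigma I B \<rightarrow>\<^sub>E C. \<forall>u\<in>Sigma I B. \<forall>v\<in>Sigma I B. fst u \<noteq> fst v \<longrightarrow> c u \<noteq> c v}"

lemma finite_part_colourings:
  assumes "finite I" "\<And>i. i \<in> I \<Longrightarrow> finite (B i)" "finite C"
  shows "finite (part_colourings I B C)"
  by (rule finite_subset[OF _ finite_PiE[of "Sigma I B" "\<lambda>_. C"]])
    (use assms in \<open>auto simp: part_colourings_def\<close>)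

lemma bij_betw_part_colourings_insert:
  assumes "i \<notin> I"
  shows "bij_betw (\<lambda>c. (\<lambda>b\<in>B i. c (i, b), restrict c (Sigma I B)))
    (part_colourings (insert i I) B C)
    (SIGMA g:B i \<rightarrow>\<^sub>E C. part_colourings I B (C - g ` B i))"
proof (rule bij_betw_byWitness[where f' = "\<lambda>(g, c) (k, b). if k = i then g b else c (k, b)"])
  show "\<forall>c\<in>part_colourings (insert i I) B C.
      (\<lambda>(g, c) (k, b). if k = i then g b else c (k, b))
        (\<lambda>b\<in>B i. c (i, b), restrict c (Sigma I B)) = c"
    by (auto simp: part_colourings_def PiE_iff extensional_def fun_eq_iff)
  show "\<forall>x\<in>SIGMA g:B i \<rightarrow>\<^sub>E C. part_colourings I B (C - g ` B i).
      (\<lambda>c. (\<lambda>b\<in>B i. c (i, b), restrict c (Sigma I B)))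
        ((\<lambda>(g, c) (k, b). if k = i then g b else c (k, b)) x) = x"
    using assms by (auto simp: part_colourings_def PiE_iff extensional_def fun_eq_iff)
  show "(\<lambda>c. (\<lambda>b\<in>B i. c (i, b), restrict c (Sigma I B))) ` part_colourings (insert i I) B C
      \<subseteq> (SIGMA g:B i \<rightarrow>\<^sub>E C. part_colourings I B (C - g ` B i))"
  proof (rule image_subsetI)
    fix c assume c: "c \<in> part_colourings (insert i I) B C"
    have "(\<lambda>b\<in>B i. c (i, b)) \<in> B i \<rightarrow>\<^sub>E C"
      using c by (auto simp: part_colourings_def)
    moreover have "c (k, b) \<noteq> c (i, b')" if "k \<in> I" "b \<in> B k" "b' \<in> B i" for k b b'
    proof -
      have "(k, b) \<in> Sigma (insert i I) B" "(i, b') \<in> Sigma (insert i I) B" "fst (k, b) \<noteq> fst (i, b')"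
        using that assms by auto
      then show ?thesis
        using c unfolding part_colourings_def by blast
    qed
    then have "restrict c (Sigma I B) \<in> part_colourings I B (C - (\<lambda>b\<in>B i. c (i, b)) ` B i)"
      using c by (fastforce simp: part_colourings_def)
    ultimately show "(\<lambda>b\<in>B i. c (i, b), restrict c (Sigma I B))
        \<in> (SIGMA g:B i \<rightarrow>\<^sub>E C. part_colourings I B (C - g ` B i))"
      by (simp only: mem_Sigma_iff)
  qed
  show "(\<lambda>(g, c) (k, b). if k = i then g b else c (k, b)) `
      (SIGMA g:B i \<rightarrow>\<^sub>E C. part_colourings I B (C - g ` B i)) \<subseteq> part_colourings (insert i I) B C"
  proof safe
    fix g c assume g: "g \<in> B i \<rightarrow>\<^sub>E C" and c: "c \<in> part_colourings I B (C - g ` B i)"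
    have c_in: "c (k, b) \<in> C - g ` B i" if "k \<in> I" "b \<in> B k" for k b
      using c that by (auto simp: part_colourings_def PiE_iff)
    have c_undef: "c (k, b) = undefined" if "\<not> (k \<in> I \<and> b \<in> B k)" for k b
      using c that by (auto simp: part_colourings_def PiE_iff extensional_def)
    have c_neq: "c (k, b) \<noteq> c (k', b')" if "k \<in> I" "b \<in> B k" "k' \<in> I" "b' \<in> B k'" "k \<noteq> k'" for k b k' b'
    proof -
      have "(k, b) \<in> Sigma I B" "(k', b') \<in> Sigma I B" "fst (k, b) \<noteq> fst (k', b')"
        using that by auto
      then show ?thesis
        using c unfolding part_colourings_def by blast
    qed
    have c_g: "c (k, b) \<noteq> g b'" "g b' \<noteq> c (k, b)" if "k \<in> I" "b \<in> B k" "b' \<in> B i" for k b b'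
      using c_in[OF that(1,2)] that(3) by (metis DiffD2 imageI)+
    show "(\<lambda>(k, b). if k = i then g b else c (k, b)) \<in> part_colourings (insert i I) B C"
      unfolding part_colourings_def
      using g c_in c_undef c_neq c_g assms
      by (auto simp: PiE_iff extensional_def)
  qed
qed

text \<open>Induction on the parts with \<open>C\<close> arbitrary: a colouring of the new part with
  \<open>j\<close> colours leaves \<open>card C - j\<close> colours for the rest, and only
  \<open>j\<close> matters for the count.\<close>

lemma card_part_colourings:
  assumes "finite I" "\<And>i. i \<in> I \<Longrightarrow> finite (B i)" "finite C"
  shows "real (card (part_colourings I B C)) =
    poly (umbral_falling (\<Prod>i\<in>I. stirling_poly (card (B i)))) (real (card C))"
  using assms
proof (induction I arbitrary: C rule: finite_induct)
  case empty
  show ?case by (simp add: part_colourings_def)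
next
  case (insert i I)
  let ?W = "\<Prod>i\<in>I. stirling_poly (card (B i))"
  have fin_PiE: "finite (B i \<rightarrow>\<^sub>E C)"
    using insert.prems by (intro finite_PiE) auto
  have "real (card (part_colourings (insert i I) B C)) =
      (\<Sum>g\<in>B i \<rightarrow>\<^sub>E C. real (card (part_colourings I B (C - g ` B i))))"
    using bij_betw_same_card[OF bij_betw_part_colourings_insert[OF insert.hyps(2), of B C]]
      insert.prems insert.hyps(1) fin_PiE
    by (subst (asm) card_SigmaI) (auto intro: finite_part_colourings)
  also have "\<dots> = (\<Sum>g\<in>B i \<rightarrow>\<^sub>E C. poly (umbral_falling ?W) (real (card C) - real (card (g ` B i))))"
  proof (rule sum.cong [OF refl])
    fix g assume "g \<in> B i \<rightarrow>\<^sub>E C"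
    then have sub: "g ` B i \<subseteq> C" and fin: "finite (g ` B i)"
      using insert.prems by auto
    have "real (card (C - g ` B i)) = real (card C) - real (card (g ` B i))"
      using card_mono[OF insert.prems(2) sub] by (simp add: card_Diff_subset[OF fin sub] of_nat_diff)
    then show "real (card (part_colourings I B (C - g ` B i))) =
        poly (umbral_falling ?W) (real (card C) - real (card (g ` B i)))"
      using insert.IH[of "C - g ` B i"] insert.prems by simp
  qed
  \<comment> \<open>The weight is
    \<open>h j = poly (umbral_falling ?W) (card C - j)\<close>.\<close>
  also have "\<dots> = (\<Sum>j\<le>card (B i). real (Stirling (card (B i)) j) * poly (falling_poly j) (card C) *
      poly (umbral_falling ?W) (real (card C) - real j))"
    using insert.prems by (intro sum_functions_card_image) auto
  \<comment> \<open>By linearity, the rule for \<open>monom 1 j * p\<close>, read from right to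
    left, absorbs the shifts by \<open>j\<close> into the product with the Touchard
    polynomial.\<close>
  also have "\<dots> = poly (umbral_falling (stirling_poly (card (B i)) * ?W)) (real (card C))"
    by (simp add: stirling_poly_def sum_distrib_right umbral_falling_sum umbral_falling_smult
        poly_sum poly_umbral_falling_monom_mult mult_ac)
  finally show ?case
    using insert.hyps by simp
qed

text \<open>Two polynomials agreeing at all natural numbers have a difference with infinitely many
  roots, so the description in \<open>chromatic_poly\<close> is unique.\<close>

lemma chromatic_poly_eqI:
  assumes "\<And>q. poly p (real q) = real (card (proper_colourings G q))"
  shows "chromatic_poly G = p"
  unfolding chromatic_poly_def
proof (rule the_equality)
  show "\<forall>q. poly p (of_nat q) = of_nat (card (proper_colourings G q))"
    using assms by simp
  fix p' :: "real poly"
  assume p': "\<forall>q. poly p' (of_nat q) = of_nat (card (proper_colourings G q))"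
  have "range real \<subseteq> {x. poly (p' - p) x = 0}"
    using p' assms by auto
  moreover have "infinite (range real)"
    by (rule range_inj_infinite) (simp add: inj_on_def)
  ultimately have "infinite {x. poly (p' - p) x = 0}"
    using finite_subset by blast
  then show "p' = p"
    using poly_roots_finite[of "p' - p"] by auto
qed

lemma proper_colourings_complete_multipartite:
  "proper_colourings (complete_multipartite r lam) q =
    part_colourings {1..r} (\<lambda>i. {1..lam i}) {..<q}"
proof -
  let ?V = "SIGMA i:{1..r}. {1..lam i}"
  have "{u, v} \<in> {{u, v} | u v. u \<in> ?V \<and> v \<in> ?V \<and> fst u \<noteq> fst v} \<longleftrightarrow> fst u \<noteq> fst v"
    if "u \<in> ?V" "v \<in> ?V" for u v
  proof
    assume "{u, v} \<in> {{u, v} | u v. u \<in> ?V \<and> v \<in> ?V \<and> fst u \<noteq> fst v}"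
    then show "fst u \<noteq> fst v"
      by (auto simp: doubleton_eq_iff)
  next
    assume "fst u \<noteq> fst v"
    then show "{u, v} \<in> {{u, v} | u v. u \<in> ?V \<and> v \<in> ?V \<and> fst u \<noteq> fst v}"
      using that by blast
  qed
  then show ?thesis
    unfolding proper_colourings_def part_colourings_def complete_multipartite_def Let_def
    by (intro Collect_cong) (simp add: Ball_def)
qed

lemma chromatic_poly_complete_multipartite:
  "chromatic_poly (complete_multipartite r lam) =
    umbral_falling (\<Prod>i=1..r. stirling_poly (lam i))"
  by (rule chromatic_poly_eqI)
    (simp add: proper_colourings_complete_multipartite card_part_colourings)

section \<open>Moments of the Gamma density\<close>

text \<open>The moment is Euler's integral for \<open>Gamma (s + n)\<close>. As the integrand is
  nonnegative, evaluating its \<open>nn_integral\<close> gives integrability as well.\<close>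

lemma has_bochner_integral_Gamma:
  fixes s :: real
  assumes "s > 0"
  shows "has_bochner_integral lborel (\<lambda>t. indicator {0<..} t * (exp (- t) * t powr (s - 1) * t ^ n))
    (pochhammer s n * Gamma s)"
proof (rule has_bochner_integral_nn_integral)
  show "(\<lambda>t. indicator {0<..} t * (exp (- t) * t powr (s - 1) * t ^ n)) \<in> borel_measurable lborel"
    by measurable
  show "AE t in lborel. 0 \<le> indicator {0<..} t * (exp (- t) * t powr (s - 1) * t ^ n)"
    by (intro AE_I2) (auto simp: indicator_def)
  have Gamma: "pochhammer s n * Gamma s = Gamma (s + real n)"
  proof -
    have "s \<notin> \<int>\<^sub>\<le>\<^sub>0"
      using assms by (auto elim!: nonpos_Ints_cases)
    moreover have "Gamma s \<noteq> 0"
      using Gamma_real_pos[OF assms] by linarith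
    ultimately show ?thesis
      by (simp add: pochhammer_Gamma)
  qed
  show "0 \<le> pochhammer s n * Gamma s"
    using assms by (simp add: Gamma Gamma_real_pos less_imp_le)
  have "(\<integral>\<^sup>+t. ennreal (indicator {0<..} t * (exp (- t) * t powr (s - 1) * t ^ n)) \<partial>lborel) =
      (\<integral>\<^sup>+t. ennreal (indicator {0..} t * t powr (s + real n - 1) / exp t) \<partial>lborel)"
  \<comment> \<open>The two integrands live on \<open>{0<..}\<close> and \<open>{0..}\<close>; the
    point 0 is discarded as a null set.\<close>
  proof (rule nn_integral_cong_AE, rule AE_mp[OF AE_lborel_singleton[of 0]], intro AE_I2 impI)
    fix t :: real assume "t \<noteq> 0"
    have "t powr (s - 1) * t ^ n = t powr (s + real n - 1)" if "t > 0"
      using that by (simp flip: powr_realpow powr_add add: algebra_simps)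
    then show "ennreal (indicator {0<..} t * (exp (- t) * t powr (s - 1) * t ^ n)) =
        ennreal (indicator {0..} t * t powr (s + real n - 1) / exp t)"
      using \<open>t \<noteq> 0\<close> by (auto simp: indicator_def exp_minus field_simps)
  qed
  also have "\<dots> = ennreal (pochhammer s n * Gamma s)"
    unfolding Gamma using assms by (intro Gamma_conv_nn_integral_real[symmetric]) simp
  finally show "(\<integral>\<^sup>+t. ennreal (indicator {0<..} t * (exp (- t) * t powr (s - 1) * t ^ n)) \<partial>lborel) =
      ennreal (pochhammer s n * Gamma s)" .
qed

text \<open>By linearity from the moments: the sign of \<open>(- t) ^ n\<close> turns the rising
  factorial at \<open>s\<close> into the falling one at \<open>- s\<close>, so integration performs
  the umbral substitution.\<close>

lemma has_bochner_integral_Gamma_poly: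
  fixes s :: real
  assumes "s > 0"
  shows "has_bochner_integral lborel
    (\<lambda>t. indicator {0<..} t * (exp (- t) * t powr (s - 1) * poly p (- t)))
    (poly (umbral_falling p) (- s) * Gamma s)"
proof -
  have "has_bochner_integral lborel
      (\<lambda>t. \<Sum>n\<le>degree p. coeff p n * (-1) ^ n * (indicator {0<..} t * (exp (- t) * t powr (s - 1) * t ^ n)))
      (\<Sum>n\<le>degree p. coeff p n * (-1) ^ n * (pochhammer s n * Gamma s))"
    by (intro has_bochner_integral_sum has_bochner_integral_mult_right has_bochner_integral_Gamma assms)
  also have "(\<lambda>t. \<Sum>n\<le>degree p. coeff p n * (-1) ^ n * (indicator {0<..} t * (exp (- t) * t powr (s - 1) * t ^ n)))
      = (\<lambda>t. indicator {0<..} t * (exp (- t) * t powr (s - 1) * poly p (- t)))"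
  proof
    fix t :: real
    show "(\<Sum>n\<le>degree p. coeff p n * (-1) ^ n * (indicator {0<..} t * (exp (- t) * t powr (s - 1) * t ^ n)))
        = indicator {0<..} t * (exp (- t) * t powr (s - 1) * poly p (- t))"
      by (simp add: poly_altdef sum_distrib_left power_minus[of t] mult_ac)
  qed
  also have "(\<Sum>n\<le>degree p. coeff p n * (-1) ^ n * (pochhammer s n * Gamma s)) =
      poly (umbral_falling p) (- s) * Gamma s"
    by (simp add: umbral_falling_def poly_sum poly_falling_poly_minus sum_distrib_left mult_ac)
  finally show ?thesis .
qed

section \<open>Components and Whitney's expansion\<close>

definition component_rel :: "'a set \<Rightarrow> 'a set set \<Rightarrow> ('a \<times> 'a) set" where
  "component_rel V A = (adj_rel A)\<^sup>* \<inter> V \<times> V"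

lemma num_components_eq: "num_components G A = card (verts G // component_rel (verts G) A)"
  by (simp add: num_components_def component_rel_def)

lemma sym_adj_rel: "sym (adj_rel A)"
  by (auto simp: adj_rel_def sym_def insert_commute)

lemma equiv_component_rel: "equiv V (component_rel V A)"
proof (rule equivI)
  show "sym (component_rel V A)"
    using sym_rtrancl[OF sym_adj_rel, of A] by (auto simp: component_rel_def sym_def)
  show "trans (component_rel V A)"
    unfolding component_rel_def by (intro trans_Int trans_rtrancl) (auto intro: transI)
qed (auto simp: component_rel_def refl_on_def)

lemma component_rel_const:
  assumes "\<And>u v. {u, v} \<in> A \<Longrightarrow> c u = c v" "(u, v) \<in> component_rel V A"
  shows "c u = c v"
proof -
  have "(u, v) \<in> (adj_rel A)\<^sup>*"
    using assms(2) by (simp add: component_rel_def)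
  then show ?thesis
    by (induction rule: rtrancl_induct) (auto simp: adj_rel_def assms(1))
qed

text \<open>Functions constant on the classes correspond to functions on the quotient, by evaluation
  at chosen representatives.\<close>

lemma card_class_functions:
  assumes "equiv V R" "finite V" "finite C"
  shows "card {c \<in> V \<rightarrow>\<^sub>E C. \<forall>(u, v)\<in>R. c u = c v} = card C ^ card (V // R)"
proof -
  have R_sub: "R \<subseteq> V \<times> V"
    using assms(1) by (rule equiv_type)
  define rep where "rep X = (SOME x. x \<in> X)" for X :: "'a set"
  have rep: "rep X \<in> X" if "X \<in> V // R" for X
    using in_quotient_imp_non_empty[OF assms(1) that] unfolding rep_def by (simp add: some_in_eq)
  have rep_V: "rep X \<in> V" if "X \<in> V // R" for X
    using rep[OF that] in_quotient_imp_subset[OF assms(1) that] by auto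
  have rep_R: "(v, rep (R `` {v})) \<in> R" if "v \<in> V" for v
    using rep[OF quotientI[OF that]] by auto
  have class_rep: "R `` {rep X} = X" if "X \<in> V // R" for X
    using that
  proof (rule quotientE)
    fix v assume "X = R `` {v}"
    then show ?thesis
      using rep[OF that] equiv_class_eq[OF assms(1), of v "rep X"] by simp
  qed
  have "bij_betw (\<lambda>c. \<lambda>X\<in>V // R. c (rep X))
      {c \<in> V \<rightarrow>\<^sub>E C. \<forall>(u, v)\<in>R. c u = c v} (V // R \<rightarrow>\<^sub>E C)"
  proof (rule bij_betw_byWitness[where f' = "\<lambda>g. \<lambda>v\<in>V. g (R `` {v})"])
    show "\<forall>c\<in>{c \<in> V \<rightarrow>\<^sub>E C. \<forall>(u, v)\<in>R. c u = c v}.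
        (\<lambda>v\<in>V. (\<lambda>X\<in>V // R. c (rep X)) (R `` {v})) = c"
    proof safe
      fix c assume c: "c \<in> V \<rightarrow>\<^sub>E C" and const: "\<forall>(u, v)\<in>R. c u = c v"
      show "(\<lambda>v\<in>V. (\<lambda>X\<in>V // R. c (rep X)) (R `` {v})) = c"
      proof
        fix v
        show "(\<lambda>v\<in>V. (\<lambda>X\<in>V // R. c (rep X)) (R `` {v})) v = c v"
        proof (cases "v \<in> V")
          case True
          then show ?thesis
            using const rep_R[OF True] by (auto simp: quotientI)
        next
          case False
          then show ?thesis
            using c by (simp add: PiE_arb[OF c])
        qed
      qed
    qed
    show "\<forall>g\<in>V // R \<rightarrow>\<^sub>E C. (\<lambda>X\<in>V // R. (\<lambda>v\<in>V. g (R `` {v})) (rep X)) = g"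
    proof
      fix g assume g: "g \<in> V // R \<rightarrow>\<^sub>E C"
      show "(\<lambda>X\<in>V // R. (\<lambda>v\<in>V. g (R `` {v})) (rep X)) = g"
      proof
        fix X
        show "(\<lambda>X\<in>V // R. (\<lambda>v\<in>V. g (R `` {v})) (rep X)) X = g X"
          using PiE_arb[OF g, of X] by (cases "X \<in> V // R") (simp_all add: rep_V class_rep)
      qed
    qed
    show "(\<lambda>c. \<lambda>X\<in>V // R. c (rep X)) ` {c \<in> V \<rightarrow>\<^sub>E C. \<forall>(u, v)\<in>R. c u = c v} \<subseteq> V // R \<rightarrow>\<^sub>E C"
      using rep_V by auto
    show "(\<lambda>g. \<lambda>v\<in>V. g (R `` {v})) ` (V // R \<rightarrow>\<^sub>E C) \<subseteq> {c \<in> V \<rightarrow>\<^sub>E C. \<forall>(u, v)\<in>R. c u = c v}"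
    proof safe
      fix g v assume "g \<in> V // R \<rightarrow>\<^sub>E C" "v \<in> V"
      then show "(\<lambda>v\<in>V. g (R `` {v})) v \<in> C"
        by (auto simp: quotientI)
    next
      fix g u v assume "(u, v) \<in> R"
      then show "(\<lambda>v\<in>V. g (R `` {v})) u = (\<lambda>v\<in>V. g (R `` {v})) v"
        using equiv_class_eq[OF assms(1) \<open>(u, v) \<in> R\<close>] R_sub by auto
    qed auto
  qed
  then show ?thesis
    using assms(2,3) by (simp add: bij_betw_same_card card_funcsetE finite_quotient R_sub)
qed

text \<open>Expansion of a product of factors 1 - 1; it serves as the inclusion-exclusion indicator
  of \<open>M = {}\<close>.\<close>

lemma sum_Pow_alternating:
  assumes "finite M"
  shows "(\<Sum>A\<in>Pow M. (-1 :: real) ^ card A) = (if M = {} then 1 else 0)"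
proof -
  have "(\<Sum>A\<in>Pow M. (-1 :: real) ^ card A) = (\<Prod>x\<in>M. 1 - 1)"
    by (subst prod_diff_conv_sum[OF assms]) simp
  then show ?thesis
    using assms by auto
qed

definition mono_edges :: "'a set set \<Rightarrow> ('a \<Rightarrow> 'b) \<Rightarrow> 'a set set" where
  "mono_edges E c = {e \<in> E. \<forall>u\<in>e. \<forall>v\<in>e. c u = c v}"

definition edges_within :: "'a sgraph \<Rightarrow> bool" where
  "edges_within G \<longleftrightarrow> finite (verts G) \<and> edges G \<subseteq> {{u, v} | u v. u \<in> verts G \<and> v \<in> verts G}"

lemma finite_edges:
  assumes "edges_within G"
  shows "finite (edges G)"
proof (rule finite_subset)
  show "edges G \<subseteq> Pow (verts G)" "finite (Pow (verts G))"
    using assms by (auto simp: edges_within_def)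
qed

lemma edge_cases:
  assumes "edges_within G" "e \<in> edges G"
  obtains u v where "e = {u, v}" "u \<in> verts G" "v \<in> verts G"
  using assms unfolding edges_within_def by blast

lemma proper_iff_mono_edges_empty:
  assumes "edges_within G"
  shows "(\<forall>u\<in>verts G. \<forall>v\<in>verts G. {u, v} \<in> edges G \<longrightarrow> c u \<noteq> c v) \<longleftrightarrow> mono_edges (edges G) c = {}"
proof
  assume *: "\<forall>u\<in>verts G. \<forall>v\<in>verts G. {u, v} \<in> edges G \<longrightarrow> c u \<noteq> c v"
  show "mono_edges (edges G) c = {}"
  proof (rule equals0I)
    fix e assume "e \<in> mono_edges (edges G) c"
    then have e: "e \<in> edges G" and const: "\<And>u v. u \<in> e \<Longrightarrow> v \<in> e \<Longrightarrow> c u = c v"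
      unfolding mono_edges_def by blast+
    obtain u v where uv: "e = {u, v}" "u \<in> verts G" "v \<in> verts G"
      using assms e by (rule edge_cases)
    have "c u = c v"
      by (rule const) (simp_all add: uv(1))
    then show False
      using * uv e by metis
  qed
next
  assume *: "mono_edges (edges G) c = {}"
  have "{u, v} \<in> mono_edges (edges G) c" if "{u, v} \<in> edges G" "c u = c v" for u v
    using that unfolding mono_edges_def by auto
  then show "\<forall>u\<in>verts G. \<forall>v\<in>verts G. {u, v} \<in> edges G \<longrightarrow> c u \<noteq> c v"
    unfolding * by blast
qed

text \<open>Equality of colours across single edges propagates along paths; conversely, the ends of
  an edge of \<open>A\<close> lie in one component.\<close>

lemma subset_mono_edges_iff:
  assumes "edges_within G" "A \<subseteq> edges G"
  shows "A \<subseteq> mono_edges (edges G) c \<longleftrightarrow> (\<forall>(u, v)\<in>component_rel (verts G) A. c u = c v)"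
proof
  assume "A \<subseteq> mono_edges (edges G) c"
  then have const: "c u = c v" if "{u, v} \<in> A" for u v
    using that unfolding mono_edges_def by blast
  have "c u = c v" if "(u, v) \<in> component_rel (verts G) A" for u v
    using const that by (rule component_rel_const)
  then show "\<forall>(u, v)\<in>component_rel (verts G) A. c u = c v"
    by auto
next
  assume *: "\<forall>(u, v)\<in>component_rel (verts G) A. c u = c v"
  show "A \<subseteq> mono_edges (edges G) c"
  proof
    fix e assume e: "e \<in> A"
    with assms(2) have "e \<in> edges G"
      by auto
    with assms(1) obtain u v where uv: "e = {u, v}" "u \<in> verts G" "v \<in> verts G"
      by (rule edge_cases)
    then have "(u, v) \<in> component_rel (verts G) A"
      using e by (auto simp: component_rel_def adj_rel_def)
    then have "c u = c v"
      using * by blast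
    then show "e \<in> mono_edges (edges G) c"
      using \<open>e \<in> edges G\<close> uv(1) unfolding mono_edges_def by auto
  qed
qed

text \<open>Inclusion-exclusion over the monochromatic edges. After the sums are exchanged, each
  \<open>A\<close> counts the colourings constant on its components, one free colour per
  component.\<close>

lemma card_proper_colourings_whitney:
  assumes G: "edges_within G"
  shows "real (card (proper_colourings G q)) =
    (\<Sum>A\<in>Pow (edges G). (-1) ^ card A * real q ^ num_components G A)"
proof -
  let ?F = "verts G \<rightarrow>\<^sub>E {..<q}"
  let ?M = "mono_edges (edges G)"
  have finV: "finite (verts G)" and finE: "finite (edges G)"
    using G finite_edges by (auto simp: edges_within_def)
  have finF: "finite ?F"
    using finV by (intro finite_PiE) auto
  have M_sub: "?M c \<subseteq> edges G" for c :: "'a \<Rightarrow> nat"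
    by (auto simp: mono_edges_def)
  have "real (card (proper_colourings G q)) = (\<Sum>c\<in>?F. if ?M c = {} then 1 else 0)"
    using finF by (simp add: proper_colourings_def proper_iff_mono_edges_empty[OF G] sum.If_cases Int_def)
  also have "\<dots> = (\<Sum>c\<in>?F. \<Sum>A\<in>Pow (?M c). (-1) ^ card A)"
    by (intro sum.cong refl sum_Pow_alternating[symmetric] finite_subset[OF M_sub finE])
  also have "\<dots> = (\<Sum>c\<in>?F. \<Sum>A\<in>Pow (edges G). if A \<subseteq> ?M c then (-1) ^ card A else 0)"
  proof (rule sum.cong [OF refl])
    fix c :: "'a \<Rightarrow> nat"
    show "(\<Sum>A\<in>Pow (?M c). (-1) ^ card A) =
        (\<Sum>A\<in>Pow (edges G). if A \<subseteq> ?M c then (-1) ^ card A else (0 :: real))"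
      using M_sub[of c] finE by (intro sum.mono_neutral_cong_left) auto
  qed
  also have "\<dots> = (\<Sum>A\<in>Pow (edges G). \<Sum>c\<in>?F. if A \<subseteq> ?M c then (-1) ^ card A else 0)"
    by (rule sum.swap)
  also have "\<dots> = (\<Sum>A\<in>Pow (edges G). (-1) ^ card A * real q ^ num_components G A)"
  proof (rule sum.cong [OF refl])
    fix A assume A: "A \<in> Pow (edges G)"
    have "(\<Sum>c\<in>?F. if A \<subseteq> ?M c then (-1) ^ card A else 0) =
        (-1) ^ card A * real (card {c \<in> ?F. \<forall>(u, v)\<in>component_rel (verts G) A. c u = c v})"
      using finF A by (simp add: subset_mono_edges_iff[OF G] sum.If_cases Int_def)
    then show "(\<Sum>c\<in>?F. if A \<subseteq> ?M c then (-1) ^ card A else 0) =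
        (-1) ^ card A * real q ^ num_components G A"
      using card_class_functions[OF equiv_component_rel finV, of "{..<q}" A] by (simp add: num_components_eq)
  qed
  finally show ?thesis .
qed

lemma chromatic_poly_whitney:
  assumes "edges_within G"
  shows "chromatic_poly G = (\<Sum>A\<in>Pow (edges G). monom ((-1) ^ card A) (num_components G A))"
  by (rule chromatic_poly_eqI) (simp add: card_proper_colourings_whitney[OF assms] poly_sum poly_monom)

section \<open>Bounds on component numbers and the Tutte evaluation\<close>

text \<open>A walk from \<open>u\<close> that uses the new edge must first cross it from
  \<open>b\<close> to \<open>a\<close>, as \<open>a\<close> is out of reach before; whatever lies
  beyond was already joined to \<open>a\<close> or is reached from \<open>u\<close> without the
  edge.\<close>

lemma reachable_insert_edge:
  assumes "(u, v) \<in> (adj_rel (insert {a, b} A))\<^sup>*" "(u, a) \<notin> (adj_rel A)\<^sup>*"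
  shows "(u, v) \<in> (adj_rel A)\<^sup>* \<or> (v, a) \<in> (adj_rel A)\<^sup>*"
proof -
  have sym: "(x, y) \<in> (adj_rel A)\<^sup>* \<Longrightarrow> (y, x) \<in> (adj_rel A)\<^sup>*" for x y
    by (rule symD[OF sym_rtrancl[OF sym_adj_rel]])
  \<comment> \<open>The invariant also records that \<open>u\<close> reaches \<open>b\<close>, so
    that a later crossing from \<open>a\<close> back to \<open>b\<close> leads to a vertex reachable
    from \<open>u\<close> in \<open>A\<close>.\<close>
  from assms(1) have "(u, v) \<in> (adj_rel A)\<^sup>* \<or> (u, b) \<in> (adj_rel A)\<^sup>* \<and> (v, a) \<in> (adj_rel A)\<^sup>*"
  proof (induction rule: rtrancl_induct)
    case base
    show ?case by simp
  next
    case (step w w')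
    consider "(w, w') \<in> adj_rel A" | "w = a" "w' = b" | "w = b" "w' = a"
      using step.hyps(2) by (auto simp: adj_rel_def doubleton_eq_iff)
    then show ?case
    proof cases
      case 1
      then have "(w', w) \<in> adj_rel A"
        by (simp add: adj_rel_def insert_commute)
      then show ?thesis
        using step.IH 1 by (meson converse_rtrancl_into_rtrancl rtrancl.rtrancl_into_rtrancl)
    next
      case 2
      then show ?thesis using step.IH assms(2) by auto
    next
      case 3
      then show ?thesis using step.IH assms(2) sym[of b a] by auto
    qed
  qed
  then show ?thesis by blast
qed

text \<open>
  With $U$ a set of representatives this is $|V| \le k(A) + |A|$, so that the truncated
  subtraction in the exponent of $y - 1$ in the Tutte polynomial is exact.
\<close>

lemma exists_independent_transversal:
  assumes "finite V" "finite A" "A \<subseteq> {{u, v} | u v. u \<in> V \<and> v \<in> V}"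
  shows "\<exists>U\<subseteq>V. card V \<le> card U + card A \<and>
    (\<forall>u\<in>U. \<forall>v\<in>U. (u, v) \<in> (adj_rel A)\<^sup>* \<longrightarrow> u = v)"
  using assms(2,3)
proof (induction A rule: finite_induct)
  case empty
  show ?case by (intro exI[of _ V]) (auto simp: adj_rel_def)
next
  case (insert e A)
  from insert.IH insert.prems obtain U where U: "U \<subseteq> V" "card V \<le> card U + card A"
    and ind: "\<And>u v. u \<in> U \<Longrightarrow> v \<in> U \<Longrightarrow> (u, v) \<in> (adj_rel A)\<^sup>* \<Longrightarrow> u = v"
    by auto
  have finU: "finite U"
    using U(1) assms(1) finite_subset by blast
  from insert.prems obtain a b where e: "e = {a, b}"
    by auto
  \<comment> \<open>\<open>W\<close> has at most one element, since any two would be joined through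
    \<open>a\<close>. Removing it is paid for by the new edge, and no two remaining representatives
    are joined by that edge.\<close>
  define W where "W = {u \<in> U. (u, a) \<in> (adj_rel A)\<^sup>*}"
  have "u = v" if "u \<in> W" "v \<in> W" for u v
  proof (rule ind)
    show "(u, v) \<in> (adj_rel A)\<^sup>*"
      using that symD[OF sym_rtrancl[OF sym_adj_rel], of v a A] unfolding W_def
      by (blast intro: rtrancl_trans)
  qed (use that in \<open>auto simp: W_def\<close>)
  then have "card W \<le> Suc 0"
    using finU by (subst card_le_Suc0_iff_eq) (auto simp: W_def)
  moreover have "card (U - W) = card U - card W"
    using finU by (intro card_Diff_subset) (auto simp: W_def)
  ultimately have "card V \<le> card (U - W) + card (insert e A)"
    using U(2) insert.hyps by simp
  moreover have "u = v" if "u \<in> U - W" "v \<in> U - W" "(u, v) \<in> (adj_rel (insert e A))\<^sup>*" for u v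
    using reachable_insert_edge[of u v a b A] that ind by (auto simp: W_def e)
  ultimately show ?case
    using U(1) by (intro exI[of _ "U - W"]) auto
qed

text \<open>The elements of an independent transversal lie in distinct components, so there are at
  most \<open>num_components G A\<close> of them.\<close>

lemma card_verts_le_components_plus_edges:
  assumes "edges_within G" "A \<subseteq> edges G"
  shows "card (verts G) \<le> num_components G A + card A"
proof -
  let ?R = "component_rel (verts G) A"
  have fin: "finite (verts G)" "finite A"
    using assms finite_edges finite_subset by (auto simp: edges_within_def)
  obtain U where U: "U \<subseteq> verts G" "card (verts G) \<le> card U + card A"
    and ind: "\<And>u v. u \<in> U \<Longrightarrow> v \<in> U \<Longrightarrow> (u, v) \<in> (adj_rel A)\<^sup>* \<Longrightarrow> u = v"
  proof -
    have "A \<subseteq> {{u, v} | u v. u \<in> verts G \<and> v \<in> verts G}"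
      using assms unfolding edges_within_def by blast
    from exists_independent_transversal[OF fin this] show ?thesis
      using that by blast
  qed
  have "inj_on (\<lambda>u. ?R `` {u}) U"
  proof (rule inj_onI)
    fix u v assume uv: "u \<in> U" "v \<in> U" "?R `` {u} = ?R `` {v}"
    then have "(u, v) \<in> ?R"
      using eq_equiv_class[OF _ equiv_component_rel] U(1) by (metis subsetD)
    then show "u = v"
      using ind uv by (auto simp: component_rel_def)
  qed
  moreover have "(\<lambda>u. ?R `` {u}) ` U \<subseteq> verts G // ?R"
    using U(1) by (auto intro: quotientI)
  moreover have "finite (verts G // ?R)"
    using fin by (intro finite_quotient) (auto simp: component_rel_def)
  ultimately have "card U \<le> num_components G A"
    unfolding num_components_eq by (rule card_inj_on_le)
  then show ?thesis
    using U(2) by simp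
qed

lemma num_components_le_card_verts:
  assumes "finite (verts G)"
  shows "num_components G A \<le> card (verts G)"
proof -
  have "verts G // component_rel (verts G) A = (\<lambda>v. component_rel (verts G) A `` {v}) ` verts G"
    by (auto simp: quotient_def)
  then show ?thesis
    using assms by (simp add: num_components_eq card_image_le)
qed

lemma num_components_pos:
  assumes "finite (verts G)" "verts G \<noteq> {}"
  shows "num_components G A > 0"
  unfolding num_components_eq
  using assms by (auto simp: card_gt_0_iff component_rel_def intro!: finite_quotient)

lemma num_components_connected:
  assumes "connected_graph G"
  shows "num_components G (edges G) = 1"
proof -
  have "component_rel (verts G) (edges G) = verts G \<times> verts G"
    using assms by (auto simp: component_rel_def connected_graph_def)
  moreover have "verts G // (verts G \<times> verts G) = {verts G}"
    using assms by (auto simp: quotient_def connected_graph_def)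
  ultimately show ?thesis
    by (simp add: num_components_eq)
qed

text \<open>At x = 1 + s, y = 0 the bases are \<open>s\<close> and -1. Connectedness gives rank |V|
  - 1, so the first exponent is k(A) - 1 and the prefactor \<open>s\<close> supplies the missing
  power.\<close>

lemma tutte_chromatic_poly:
  assumes G: "edges_within G" and conn: "connected_graph G"
  shows "(-1) ^ card (verts G) * poly (chromatic_poly G) (- s) = s * tutte G (1 + s) 0"
proof -
  let ?N = "card (verts G)" and ?k = "num_components G"
  have fin: "finite (verts G)" and ne: "verts G \<noteq> {}"
    using G conn by (auto simp: edges_within_def connected_graph_def)
  have "(-1) ^ ?N * poly (chromatic_poly G) (- s) =
      (\<Sum>A\<in>Pow (edges G). (-1) ^ ?N * ((-1) ^ card A * (- s) ^ ?k A))"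
    by (simp add: chromatic_poly_whitney[OF G] poly_sum poly_monom sum_distrib_left)
  also have "\<dots> = (\<Sum>A\<in>Pow (edges G). s * (s ^ (graph_rank G (edges G) - graph_rank G A) *
      (-1) ^ (card A - graph_rank G A)))"
  proof (rule sum.cong [OF refl])
    fix A assume "A \<in> Pow (edges G)"
    then have 1: "?N \<le> ?k A + card A"
      using card_verts_le_components_plus_edges[OF G] by simp
    have 2: "?k A \<le> ?N" "?k A > 0"
      using num_components_le_card_verts[OF fin] num_components_pos[OF fin ne] by auto
    have r1: "Suc (graph_rank G (edges G) - graph_rank G A) = ?k A"
      using 2 num_components_connected[OF conn] by (simp add: graph_rank_def)
    \<comment> \<open>Sign bookkeeping: the total exponent of -1 differs from the nullity of
      \<open>A\<close> by the even number \<open>2 * ?N\<close>. The bounds above make both natural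
      subtractions exact.\<close>
    have r2: "?N + (card A + ?k A) = card A - graph_rank G A + 2 * ?N"
      using 1 2 by (simp add: graph_rank_def)
    have "(-1) ^ ?N * ((-1) ^ card A * (- s) ^ ?k A) = (-1) ^ (?N + (card A + ?k A)) * s ^ ?k A"
      by (simp add: power_add power_minus[of s])
    also have "\<dots> = (-1) ^ (card A - graph_rank G A) * s ^ ?k A"
      unfolding r2 by (simp add: power_add)
    also have "s ^ ?k A = s * s ^ (graph_rank G (edges G) - graph_rank G A)"
      by (simp flip: r1)
    finally show "(-1) ^ ?N * ((-1) ^ card A * (- s) ^ ?k A) =
        s * (s ^ (graph_rank G (edges G) - graph_rank G A) * (-1) ^ (card A - graph_rank G A))"
      by (simp add: mult_ac)
  qed
  finally show ?thesis
    by (simp add: tutte_def sum_distrib_left)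
qed

theorem proposition2:
  fixes s :: real and r :: nat and lam :: "nat \<Rightarrow> nat" and N :: nat
    and G :: "(nat \<times> nat) sgraph" and H :: real and f :: "real \<Rightarrow> real"
  assumes "s > 0"
    and "\<And>i. i \<in> {1..r} \<Longrightarrow> lam i > 0"
    and "N = (\<Sum>i=1..r. lam i)"
    and "G = complete_multipartite r lam"
    and "H = (-1) ^ N * poly (chromatic_poly G) (- s)"
    and "f = (\<lambda>t. exp (- t) * t powr (s - 1) * (\<Prod>i=1..r. P (lam i) t))"
  shows "set_integrable lborel {0<..} f \<and>
         H = 1 / Gamma s * (LBINT t:{0<..}. f t) \<and>
         (connected_graph G \<longrightarrow> H = s * tutte G (1 + s) 0)"
proof -
  let ?W = "\<Prod>i=1..r. stirling_poly (lam i)"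
  \<comment> \<open>The signs \<open>(-1) ^ lam i\<close> multiply to \<open>(-1) ^ N\<close>;
    positivity of the parts allows the rewriting of each \<open>P\<close>.\<close>
  have prod_P: "(\<Prod>i=1..r. P (lam i) t) = (-1) ^ N * poly ?W (- t)" for t
    using assms(2) by (simp add: P_eq_stirling_poly prod.distrib power_sum poly_prod assms(3))
  have "has_bochner_integral lborel
      (\<lambda>t. (-1) ^ N * (indicator {0<..} t * (exp (- t) * t powr (s - 1) * poly ?W (- t))))
      ((-1) ^ N * (poly (umbral_falling ?W) (- s) * Gamma s))"
    by (intro has_bochner_integral_mult_right has_bochner_integral_Gamma_poly assms(1))
  also have "(\<lambda>t. (-1) ^ N * (indicator {0<..} t * (exp (- t) * t powr (s - 1) * poly ?W (- t)))) =
      (\<lambda>t. indicator {0<..} t *\<^sub>R f t)"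
    unfolding assms(6) prod_P by (simp add: mult_ac)
  also have "(-1) ^ N * (poly (umbral_falling ?W) (- s) * Gamma s) = H * Gamma s"
    by (simp add: assms(4,5) chromatic_poly_complete_multipartite)
  \<comment> \<open>This yields integrability and the value together; dividing by the nonzero
    \<open>Gamma s\<close> gives the formula.\<close>
  finally have integral: "has_bochner_integral lborel (\<lambda>t. indicator {0<..} t *\<^sub>R f t) (H * Gamma s)" .
  have "edges_within G"
    by (auto simp: edges_within_def assms(4) complete_multipartite_def Let_def)
  moreover have "N = card (verts G)"
    by (simp add: assms(3,4) complete_multipartite_def Let_def)
  ultimately have "connected_graph G \<longrightarrow> H = s * tutte G (1 + s) 0"
    using tutte_chromatic_poly assms(5) by blast
  moreover have "Gamma s \<noteq> 0"
    using Gamma_real_pos[OF assms(1)] by simp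
  ultimately show ?thesis
    using integral
    by (simp add: has_bochner_integral_iff set_integrable_def set_lebesgue_integral_def)
qed

end
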